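(* Let $m,k\in\mathbb{N}$ with $k<2m$, and let $a>0$. For $n\ge 0$ let $r_{m,k}(n)=\#\{(x_1,\dots,x_k)\in\mathbb{Z}^k : x_1^{2m}+\cdots+x_k^{2m}=n\}$, and for $z>0$ let $U_{2m}(z)=\sum_{t\in\mathbb{Z}}\frac{1}{t^{2m}+z^{2m}}$. Then \[ \sum_{n=0}^{\infty}\frac{r_{m,k}(n)}{n+a}\;\ge\;\frac{1}{k}\,U_{2m}\!\left(\left(\tfrac{a}{k}\right)^{1/(2m)}\right). \]
   Context: $\mathbb{N}$ denotes the positive integers. $r_{m,k}(n)$ counts representations of $n$ as a sum of $k$ $(2m)$-th powers of integers (signs and order counted). $U_{2m}$ is called the generalized cotangent series. *)

theory Defs
  imports "HOL-Analysis.Analysis"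
begin

definition rep_tuples :: "nat \<Rightarrow> nat \<Rightarrow> nat \<Rightarrow> (nat \<Rightarrow> int) set" where
  "rep_tuples m k n = {x \<in> {1..k} \<rightarrow>\<^sub>E UNIV. (\<Sum>i=1..k. x i ^ (2 * m)) = int n}"

definition rep_count :: "nat \<Rightarrow> nat \<Rightarrow> nat \<Rightarrow> nat" where
  "rep_count m k n = card (rep_tuples m k n)"

text \<open>The argument \<open>d\<close> is the exponent, so the series \<open>U\<^bsub>2m\<^esub>\<close> is \<open>gen_cot (2 * m)\<close>.\<close>

definition gen_cot :: "nat \<Rightarrow> real \<Rightarrow> real" where
  "gen_cot d z = (\<Sum>\<^sub>\<infinity>t\<in>(UNIV :: int set). 1 / (real_of_int t ^ d + z ^ d))"

text \<open>The next two facts exclude the junk values of \<open>card\<close> (infinite set) and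
  \<open>infsum\<close> (divergent family).\<close>

lemma finite_rep_tuples:
  assumes "1 \<le> m"
  shows "finite (rep_tuples m k n)"
proof (rule finite_subset)
  show "finite ({1..k} \<rightarrow>\<^sub>E {- int n..int n})"
    by (intro finite_PiE) auto
  show "rep_tuples m k n \<subseteq> {1..k} \<rightarrow>\<^sub>E {- int n..int n}"
  proof
    fix x assume x: "x \<in> rep_tuples m k n"
    have "x i \<in> {- int n..int n}" if i: "i \<in> {1..k}" for i
    proof -
      have "x i ^ (2 * m) \<le> (\<Sum>i=1..k. x i ^ (2 * m))"
        by (rule member_le_sum[OF i]) auto
      also have "\<dots> = int n"
        using x by (simp add: rep_tuples_def)
      finally have le: "\<bar>x i\<bar> ^ (2 * m) \<le> int n"
        by (simp add: power_even_abs)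
      have "\<bar>x i\<bar> \<le> \<bar>x i\<bar> ^ (2 * m)"
        using assms by (cases "x i = 0") (auto intro!: self_le_power)
      with le show ?thesis by auto
    qed
    with x show "x \<in> {1..k} \<rightarrow>\<^sub>E {- int n..int n}"
      by (auto simp: rep_tuples_def PiE_iff)
  qed
qed

lemma gen_cot_summable_on:
  fixes z :: real
  assumes "1 \<le> m" and "z > 0"
  shows "(\<lambda>t::int. 1 / (real_of_int t ^ (2 * m) + z ^ (2 * m))) summable_on UNIV"
proof -
  let ?f = "\<lambda>t::int. 1 / (real_of_int t ^ (2 * m) + z ^ (2 * m))"
  have nn: "?f t \<ge> 0" for t
    using assms by (auto intro!: add_nonneg_nonneg)
  have "summable (\<lambda>n. ?f (int n))"
  proof (rule summable_comparison_test)
    show "summable (\<lambda>n. inverse (real n ^ 2))"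
      using inverse_power_summable[of 2, where 'a = real] by simp
    have "norm (?f (int n)) \<le> inverse (real n ^ 2)" if "n \<ge> 1" for n
    proof -
      have "real n ^ 2 \<le> real n ^ (2 * m)"
        using that assms by (intro power_increasing) auto
      then have "real n ^ 2 \<le> real n ^ (2 * m) + z ^ (2 * m)"
        using assms by (smt (verit) zero_le_power)
      then have "?f (int n) \<le> 1 / real n ^ 2"
        using that by (intro divide_left_mono mult_pos_pos) (auto intro: less_le_trans[rotated])
      then show ?thesis
        using nn[of "int n"] by (simp add: inverse_eq_divide)
    qed
    then show "\<exists>N. \<forall>n\<ge>N. norm (?f (int n)) \<le> inverse (real n ^ 2)"
      by blast
  qed
  then have nat: "(\<lambda>n. ?f (int n)) summable_on UNIV"
    using nn by (subst summable_on_UNIV_nonneg_real_iff) auto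
  have pos: "?f summable_on range int"
    using nat by (subst summable_on_reindex) (auto simp: o_def)
  have neg: "?f summable_on range (\<lambda>n. - int n)"
    using nat by (subst summable_on_reindex) (auto simp: o_def inj_on_def)
  have "(UNIV :: int set) = range int \<union> range (\<lambda>n. - int n)"
    by (auto simp: image_iff) (metis int_cases2)
  then show ?thesis
    using summable_on_union[OF pos neg] by simp
qed

end

theory Submission
  imports Defs
begin

text \<open>Regrouping by the value \<open>n\<close>, the left-hand side is the sum of
  \<open>1 / (x\<^sub>1\<^sup>2\<^sup>m + \<dots> + x\<^sub>k\<^sup>2\<^sup>m + a)\<close> over all integer tuples, and the right-hand side is the
  part of that sum coming from the constant tuples. Convergence: with \<open>p = 2m > k\<close>, every
  \<open>(1 + \<bar>x\<^sub>i\<bar>)\<^sup>p\<close> is at most a constant times the denominator, hence so is their geometric mean,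
  and the family is dominated by a product of convergent one-variable series
  \<open>\<Sum> (1 + \<bar>t\<bar>)\<close> to the power \<open>- p / k\<close>.\<close>

lemma summable_on_prod_PiE_real:
  fixes f :: "'a \<Rightarrow> 'b \<Rightarrow> real"
  assumes "finite A" and "\<And>i. i \<in> A \<Longrightarrow> countable (B i)"
    and "\<And>i. i \<in> A \<Longrightarrow> f i summable_on B i"
  shows "(\<lambda>g. \<Prod>i\<in>A. f i (g i)) summable_on PiE A B"
proof -
  have "Infinite_Set_Sum.abs_summable_on (f i) (B i)" if "i \<in> A" for i
    using assms(3)[OF that]
    unfolding abs_summable_equivalent[symmetric] summable_on_iff_abs_summable_on_real[symmetric] .
  then have "Infinite_Set_Sum.abs_summable_on (\<lambda>g. \<Prod>i\<in>A. f i (g i)) (PiE A B)"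
    using assms by (intro abs_summable_on_prod_PiE) auto
  then show ?thesis
    unfolding abs_summable_equivalent[symmetric] summable_on_iff_abs_summable_on_real[symmetric] .
qed

lemma summable_on_UNIV_intI:
  fixes f :: "int \<Rightarrow>
    'a::{uniform_topological_group_add, topological_comm_monoid_add, ab_group_add, complete_uniform_space}"
  assumes nonneg: "(\<lambda>n. f (int n)) summable_on UNIV"
    and nonpos: "(\<lambda>n. f (- int n)) summable_on UNIV"
  shows "f summable_on UNIV"
proof -
  have "f summable_on range int"
    using nonneg by (subst summable_on_reindex) (auto simp: o_def)
  moreover have "f summable_on range (\<lambda>n. - int n)"
    using nonpos by (subst summable_on_reindex) (auto simp: o_def inj_on_def)
  ultimately have "f summable_on range int \<union> range (\<lambda>n. - int n)"
    by (rule summable_on_union)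
  also have "range int \<union> range (\<lambda>n. - int n) = UNIV"
    by (auto simp: image_iff) (metis int_cases2)
  finally show ?thesis .
qed

lemma one_plus_abs_powr_summable_on_int:
  fixes s :: real
  assumes "s < -1"
  shows "(\<lambda>t::int. (1 + \<bar>real_of_int t\<bar>) powr s) summable_on UNIV"
proof -
  have "summable (\<lambda>n. real (Suc n) powr s)"
    using assms by (subst summable_Suc_iff) (simp add: summable_real_powr_iff)
  then have "(\<lambda>n. (1 + real n) powr s) summable_on UNIV"
    by (subst summable_on_UNIV_nonneg_real_iff) auto
  then show ?thesis
    by (intro summable_on_UNIV_intI) simp_all
qed

lemma has_sum_card_fibre:
  fixes f :: "'b \<Rightarrow> 'c::{topological_comm_monoid_add, t3_space, semiring_1}"
  assumes sum: "((\<lambda>x. f (h x)) has_sum S) A"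
    and fin: "\<And>y. y \<in> B \<Longrightarrow> finite {x \<in> A. h x = y}"
    and "h \<in> A \<rightarrow> B"
  shows "((\<lambda>y. of_nat (card {x \<in> A. h x = y}) * f y) has_sum S) B"
proof -
  have "((\<lambda>(y, x). f y) has_sum S) (SIGMA y:B. {x \<in> A. h x = y})"
    using sum \<open>h \<in> A \<rightarrow> B\<close>
    by (subst has_sum_reindex_bij_witness[where i = "\<lambda>x. (h x, x)" and j = snd and h = "\<lambda>x. f (h x)"])
      auto
  then show ?thesis
    by (rule has_sum_SigmaD) (auto intro!: has_sum_finiteI simp: fin)
qed

lemma infsum_compose_inj_le:
  fixes g :: "'a \<Rightarrow> real"
  assumes "g summable_on A" and "\<And>x. x \<in> A \<Longrightarrow> 0 \<le> g x"
    and "inj_on h B" and "h ` B \<subseteq> A"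
  shows "(\<Sum>\<^sub>\<infinity>t\<in>B. g (h t)) \<le> infsum g A"
proof -
  have "(\<Sum>\<^sub>\<infinity>t\<in>B. g (h t)) = infsum g (h ` B)"
    using assms(3) by (simp add: infsum_reindex o_def)
  also have "\<dots> \<le> infsum g A"
    using assms by (intro infsum_mono2 summable_on_subset_banach[OF assms(1)]) auto
  finally show ?thesis .
qed

lemma prod_le_of_power_card_le:
  fixes f :: "'a \<Rightarrow> 'b::linordered_idom"
  assumes "finite A" and "A \<noteq> {}" and "0 \<le> M"
    and "\<And>i. i \<in> A \<Longrightarrow> 0 \<le> f i" and "\<And>i. i \<in> A \<Longrightarrow> f i ^ card A \<le> M"
  shows "prod f A \<le> M"
proof -
  have "prod f A ^ card A = (\<Prod>i\<in>A. f i ^ card A)"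
    by (rule prod_power_distrib)
  also have "\<dots> \<le> (\<Prod>i\<in>A. M)"
    using assms by (intro prod_mono) simp
  finally show ?thesis
    using assms by (simp add: power_mono_iff prod_nonneg card_gt_0_iff)
qed

lemma one_plus_powr_le:
  fixes x p :: real
  assumes "0 \<le> x" and "0 \<le> p"
  shows "(1 + x) powr p \<le> 2 powr p * (1 + x powr p)"
proof -
  have "(1 + x) powr p \<le> (2 * max 1 x) powr p"
    using assms by (intro powr_mono2) auto
  also have "\<dots> = 2 powr p * max 1 x powr p"
    using assms by (simp add: powr_mult)
  also have "max 1 x powr p \<le> 1 + x powr p"
    by (simp add: max_def)
  finally show ?thesis by simp
qed

lemma prod_one_plus_abs_powr_le:
  fixes y :: "'a \<Rightarrow> real"
  assumes "finite A" and "A \<noteq> {}" and "0 \<le> p" and "0 < a"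
  shows "(\<Prod>i\<in>A. (1 + \<bar>y i\<bar>) powr (p / real (card A)))
           \<le> 2 powr p * (1 + 1 / a) * ((\<Sum>i\<in>A. \<bar>y i\<bar> powr p) + a)"
proof (rule prod_le_of_power_card_le)
  define S where "S = (\<Sum>i\<in>A. \<bar>y i\<bar> powr p) + a"
  show "0 \<le> 2 powr p * (1 + 1 / a) * S"
    using assms by (simp add: S_def sum_nonneg)
  fix i assume i: "i \<in> A"
  have "((1 + \<bar>y i\<bar>) powr (p / real (card A))) ^ card A = (1 + \<bar>y i\<bar>) powr p"
    using assms by (simp add: powr_powr flip: powr_realpow)
  also have "\<dots> \<le> 2 powr p * (1 + \<bar>y i\<bar> powr p)"
    using assms by (intro one_plus_powr_le) auto
  also have "1 + \<bar>y i\<bar> powr p \<le> (1 + 1 / a) * (\<bar>y i\<bar> powr p + a)"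
    using assms by (simp add: field_simps)
  also have "\<bar>y i\<bar> powr p + a \<le> S"
    unfolding S_def using assms i by (intro add_right_mono member_le_sum) auto
  finally show "((1 + \<bar>y i\<bar>) powr (p / real (card A))) ^ card A \<le> 2 powr p * (1 + 1 / a) * S"
    using assms by (simp add: mult.assoc mult_left_mono)
qed (use assms in auto)

lemma inverse_sum_abs_powr_summable_on:
  fixes p a :: real
  assumes "finite A" and "real (card A) < p" and "0 < a"
  shows "(\<lambda>x. 1 / ((\<Sum>i\<in>A. \<bar>real_of_int (x i)\<bar> powr p) + a)) summable_on (A \<rightarrow>\<^sub>E (UNIV :: int set))"
proof (cases "A = {}")
  case False
  define s where "s = p / real (card A)"
  define C where "C = 2 powr p * (1 + 1 / a)"
  have "1 < s"
    using assms False by (simp add: s_def field_simps card_gt_0_iff)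
  then have majorant: "(\<lambda>x. C * (\<Prod>i\<in>A. (1 + \<bar>real_of_int (x i)\<bar>) powr (- s)))
      summable_on (A \<rightarrow>\<^sub>E (UNIV :: int set))"
    using assms by (intro summable_on_cmult_right summable_on_prod_PiE_real
        one_plus_abs_powr_summable_on_int) auto
  show ?thesis
  proof (rule summable_on_comparison_test[OF majorant])
    fix x :: "'a \<Rightarrow> int"
    define S where "S = (\<Sum>i\<in>A. \<bar>real_of_int (x i)\<bar> powr p) + a"
    define P where "P = (\<Prod>i\<in>A. (1 + \<bar>real_of_int (x i)\<bar>) powr s)"
    have "0 < S"
      unfolding S_def using assms by (intro add_nonneg_pos sum_nonneg) auto
    then show "0 \<le> 1 / S" by simp
    have "0 < P"
      by (auto simp: P_def intro!: prod_pos)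
    moreover have "P \<le> C * S"
      unfolding P_def C_def S_def s_def using assms False
      by (intro prod_one_plus_abs_powr_le) auto
    ultimately have "1 / S \<le> C * (1 / P)"
      using \<open>0 < S\<close> by (simp add: field_simps)
    then show "1 / S \<le> C * (\<Prod>i\<in>A. (1 + \<bar>real_of_int (x i)\<bar>) powr (- s))"
      by (simp add: P_def powr_minus_divide prod_dividef)
  qed
qed simp

definition inverse_power_sum :: "'a set \<Rightarrow> nat \<Rightarrow> real \<Rightarrow> ('a \<Rightarrow> int) \<Rightarrow> real" where
  "inverse_power_sum A d a x = 1 / (real_of_int (\<Sum>i\<in>A. x i ^ d) + a)"

lemma inverse_power_sum_nonneg:
  assumes "even d" and "0 \<le> a"
  shows "0 \<le> inverse_power_sum A d a x"
  using assms by (simp add: inverse_power_sum_def sum_nonneg zero_le_even_power)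

lemma inverse_power_sum_const:
  "inverse_power_sum A d a (\<lambda>i\<in>A. t) = 1 / (real (card A) * real_of_int t ^ d + a)"
  by (simp add: inverse_power_sum_def)

lemma inverse_power_sum_summable_on:
  assumes "finite A" and "even d" and "card A < d" and "0 < a"
  shows "inverse_power_sum A d a summable_on (A \<rightarrow>\<^sub>E UNIV)"
proof -
  have "\<bar>real_of_int t\<bar> powr real d = real_of_int t ^ d" for t
    using assms by (simp add: powr_realpow' power_even_abs)
  then show ?thesis
    using inverse_sum_abs_powr_summable_on[of A "real d" a] assms
    by (simp add: inverse_power_sum_def[abs_def])
qed

lemma infsum_const_le_infsum_inverse_power_sum:
  assumes "finite A" and "A \<noteq> {}" and "even d" and "card A < d" and "0 < a"
  shows "(\<Sum>\<^sub>\<infinity>t::int. 1 / (real (card A) * real_of_int t ^ d + a))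
           \<le> infsum (inverse_power_sum A d a) (A \<rightarrow>\<^sub>E UNIV)"
proof -
  have inj: "inj (\<lambda>t::int. \<lambda>i\<in>A. t)"
    using \<open>A \<noteq> {}\<close> by (auto simp: inj_def fun_eq_iff split: if_splits)
  have tuples: "range (\<lambda>t::int. \<lambda>i\<in>A. t) \<subseteq> A \<rightarrow>\<^sub>E UNIV"
    by auto
  show ?thesis
    unfolding inverse_power_sum_const[symmetric]
    by (rule infsum_compose_inj_le[OF _ _ inj tuples])
      (use assms in \<open>simp_all add: inverse_power_sum_summable_on inverse_power_sum_nonneg\<close>)
qed

lemma rep_tuples_eq_fibre:
  "rep_tuples m k n = {x \<in> {1..k} \<rightarrow>\<^sub>E UNIV. nat (\<Sum>i=1..k. x i ^ (2 * m)) = n}"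
proof -
  have "0 \<le> (\<Sum>i=1..k. x i ^ (2 * m))" for x :: "nat \<Rightarrow> int"
    by (intro sum_nonneg) simp
  then show ?thesis
    by (auto simp: rep_tuples_def)
qed

lemma gen_cot_powr_inverse:
  assumes "0 < d" and "0 < a" and "0 < c"
  shows "1 / c * gen_cot d ((a / c) powr (1 / real d)) = (\<Sum>\<^sub>\<infinity>t. 1 / (c * real_of_int t ^ d + a))"
proof -
  have "((a / c) powr (1 / real d)) ^ d = a / c"
    using assms by (simp add: powr_powr flip: powr_realpow)
  then have "1 / c * (1 / (real_of_int t ^ d + ((a / c) powr (1 / real d)) ^ d))
      = 1 / (c * real_of_int t ^ d + a)" for t
    using assms by (simp add: distrib_left)
  then show ?thesis
    unfolding gen_cot_def infsum_cmult_right'[symmetric] by simp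
qed

lemma rep_count_sums:
  assumes "k < 2 * m" and "0 < a"
  shows "(\<lambda>n. real (rep_count m k n) / (real n + a)) sums
           infsum (inverse_power_sum {1..k} (2 * m) a) ({1..k} \<rightarrow>\<^sub>E UNIV)"
    (is "_ sums ?S")
proof -
  let ?N = "\<lambda>x :: nat \<Rightarrow> int. nat (\<Sum>i=1..k. x i ^ (2 * m))"
  have family_eq: "inverse_power_sum {1..k} (2 * m) a x = 1 / (real (?N x) + a)" for x
    by (simp add: inverse_power_sum_def sum_nonneg)
  have "(inverse_power_sum {1..k} (2 * m) a has_sum ?S) ({1..k} \<rightarrow>\<^sub>E UNIV)"
    using assms by (intro has_sum_infsum inverse_power_sum_summable_on) auto
  then have "((\<lambda>x. 1 / (real (?N x) + a)) has_sum ?S) ({1..k} \<rightarrow>\<^sub>E UNIV)"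
    by (rule has_sum_cong[THEN iffD1, rotated]) (rule family_eq)
  then have "((\<lambda>n. real (card (rep_tuples m k n)) * (1 / (real n + a))) has_sum ?S) UNIV"
    unfolding rep_tuples_eq_fibre
    by (rule has_sum_card_fibre)
      (use finite_rep_tuples[of m k] assms in \<open>simp_all add: rep_tuples_eq_fibre\<close>)
  then show ?thesis
    by (simp add: rep_count_def has_sum_imp_sums)
qed

theorem theorem2p1:
  fixes m k :: nat and a :: real
  assumes "1 \<le> m" and "1 \<le> k" and "k < 2 * m" and "a > 0"
  shows "summable (\<lambda>n. real (rep_count m k n) / (real n + a)) \<and>
         (\<Sum>n. real (rep_count m k n) / (real n + a))
           \<ge> 1 / real k * gen_cot (2 * m) ((a / real k) powr (1 / real (2 * m)))"
proof
  let ?family = "inverse_power_sum {1..k} (2 * m) a" and ?tuples = "{1..k} \<rightarrow>\<^sub>E (UNIV :: int set)"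
  have sums: "(\<lambda>n. real (rep_count m k n) / (real n + a)) sums infsum ?family ?tuples"
    using assms by (intro rep_count_sums)
  then show "summable (\<lambda>n. real (rep_count m k n) / (real n + a))"
    by (rule sums_summable)
  have "1 / real k * gen_cot (2 * m) ((a / real k) powr (1 / real (2 * m)))
      = (\<Sum>\<^sub>\<infinity>t. 1 / (real k * real_of_int t ^ (2 * m) + a))"
    using assms by (intro gen_cot_powr_inverse) auto
  also have "\<dots> \<le> infsum ?family ?tuples"
    using infsum_const_le_infsum_inverse_power_sum[of "{1..k}" "2 * m" a] assms by simp
  also have "\<dots> = (\<Sum>n. real (rep_count m k n) / (real n + a))"
    using sums by (rule sums_unique)
  finally show "1 / real k * gen_cot (2 * m) ((a / real k) powr (1 / real (2 * m)))
      \<le> (\<Sum>n. real (rep_count m k n) / (real n + a))" .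
qed

end
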